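(* Let $G$ be a group of $N\ge 2$ individuals with $T\ge 1$ traits, where trait $t$ takes mutually exclusive values in $\{1,\dots,v_t\}$. Let $\boldsymbol{\mathcal{C}}=\prod_{t=1}^T\{1,\dots,v_t\}$, $C=|\boldsymbol{\mathcal{C}}|=v_1v_2\cdots v_T\ge 2$, and let $p=(p_c)_{c\in\boldsymbol{\mathcal{C}}}$ be the vector of proportions of aggregate identities in $G$. Let $\mathcal{D}$, $\mathcal{S}$ and $\mathcal{S}_N$ be the Intersecting Diversity, the Shared Identity, and the Shared Identity without replacement of $G$ (defined in the context). Then: (i) $\displaystyle 1-\frac{C-1}{C}\mathcal{D}\le \mathcal{S}\le 1-\frac{C-1}{TC}\mathcal{D}$; (ii) $\displaystyle \mathcal{S}_{\min}:=\frac1T\sum_{t=1}^T\frac1{v_t}\le \mathcal{S}$; (iii) $\displaystyle \langle\nabla\mathcal{D},\nabla\mathcal{S}\rangle\le-\frac{4C}{C-1}\mathcal{S}_{\min}<0$, where the gradients are evaluated at $p$. In particular, if $T=1$, then $\mathcal{S}=1-\frac{C-1}{C}\mathcal{D}$. Furthermore, $\mathcal{S}=\left(1-\frac1N\right)\mathcal{S}_N+\frac1N$, and for all real numbers $a,b$ the estimate $a\le\mathcal{S}\le b$ is equivalent to the estimate $\frac{aN-1}{N-1}\le\mathcal{S}_N\le\frac{bN-1}{N-1}$.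
   Context: Each individual $j\in G$ has exactly one value for each trait, so there is a map $Z:G\to\boldsymbol{\mathcal{C}}$, $Z(j)=(Z_1(j),\dots,Z_T(j))$, giving the aggregate identity of $j$. Each $v_t$ is a positive integer. The proportion of individuals with aggregate identity $c\in\boldsymbol{\mathcal{C}}$ is $p_c=\frac1N|\{j\in G: Z(j)=c\}|$, so $p_c\ge0$ and $\sum_c p_c=1$. For $i,j\in G$, $X(i,j)=|\{t: Z_t(i)=Z_t(j)\}|$ is the number of traits shared by $i$ and $j$. Intersecting Diversity: $\mathcal{D}=\mathcal{D}(p)=\frac{C}{C-1}\left(1-\sum_{c\in\boldsymbol{\mathcal{C}}}p_c^2\right)$. Shared Identity: $\mathcal{S}=\mathcal{S}(p)=\frac1T\sum_{t=1}^T\sum_{v=1}^{v_t}\Big(\sum_{c\in\boldsymbol{\mathcal{C}},\,c_t=v}p_c\Big)^2$, where $c_t$ is the $t$-th component of $c$. Shared Identity without replacement: $\mathcal{S}_N=\frac1T\,\frac{\sum_{i>j}X(i,j)}{\binom N2}$, the sum being over unordered pairs of distinct individuals (with $G$ identified with $\{1,\dots,N\}$). In (iii), $\mathcal{D}$ and $\mathcal{S}$ are regarded as the polynomial functions of $p\in\mathbb{R}^C$ given by the formulas above, $\nabla$ is the gradient with respect to all coordinates $p_c$ in $\mathbb{R}^C$ (not the gradient along the simplex), and $\langle\cdot,\cdot\rangle$ is the Euclidean inner product. *)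

theory Defs
  imports "HOL-Analysis.Analysis"
begin

text \<open>
  An aggregate identity is a function on the trait indices \<open>{1..T}\<close>, taken extensional
  (undefined outside \<open>{1..T}\<close>) so that equality of identities is equality of all traits.
  A vector in \<open>\<real>\<^sup>C\<close> is a function \<open>(nat \<Rightarrow> nat) \<Rightarrow> real\<close> of which only the values on
  \<open>identities T v\<close> matter.
\<close>

definition identities :: "nat \<Rightarrow> (nat \<Rightarrow> nat) \<Rightarrow> (nat \<Rightarrow> nat) set" where
  "identities T v = (\<Pi>\<^sub>E t\<in>{1..T}. {1..v t})"

lemma card_identities: "card (identities T v) = (\<Prod>t=1..T. v t)"
  by (simp add: identities_def card_PiE)

definition proportion :: "'a set \<Rightarrow> ('a \<Rightarrow> nat \<Rightarrow> nat) \<Rightarrow> (nat \<Rightarrow> nat) \<Rightarrow> real" where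
  "proportion G Z c = real (card {j \<in> G. Z j = c}) / real (card G)"

definition intersecting_diversity ::
    "nat \<Rightarrow> (nat \<Rightarrow> nat) \<Rightarrow> ((nat \<Rightarrow> nat) \<Rightarrow> real) \<Rightarrow> real" where
  "intersecting_diversity T v p =
     real (card (identities T v)) / (real (card (identities T v)) - 1) *
       (1 - (\<Sum>c\<in>identities T v. (p c)\<^sup>2))"

definition shared_identity ::
    "nat \<Rightarrow> (nat \<Rightarrow> nat) \<Rightarrow> ((nat \<Rightarrow> nat) \<Rightarrow> real) \<Rightarrow> real" where
  "shared_identity T v p =
     1 / real T * (\<Sum>t=1..T. \<Sum>u=1..v t. (\<Sum>c\<in>{c \<in> identities T v. c t = u}. p c)\<^sup>2)"

definition shared_identity_min :: "nat \<Rightarrow> (nat \<Rightarrow> nat) \<Rightarrow> real" where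
  "shared_identity_min T v = 1 / real T * (\<Sum>t=1..T. 1 / real (v t))"

definition shared_traits :: "nat \<Rightarrow> ('a \<Rightarrow> nat \<Rightarrow> nat) \<Rightarrow> 'a \<Rightarrow> 'a \<Rightarrow> nat" where
  "shared_traits T Z i j = card {t \<in> {1..T}. Z i t = Z j t}"

text \<open>
  The labelling \<open>l\<close> is meant to be a bijection from \<open>G\<close> onto \<open>{1..card G}\<close>; it serves only
  to list each unordered pair of distinct individuals exactly once.
\<close>

definition shared_identity_without_replacement ::
    "nat \<Rightarrow> 'a set \<Rightarrow> ('a \<Rightarrow> nat) \<Rightarrow> ('a \<Rightarrow> nat \<Rightarrow> nat) \<Rightarrow> real" where
  "shared_identity_without_replacement T G l Z =
     1 / real T *
       ((\<Sum>(i, j)\<in>{(i, j). i \<in> G \<and> j \<in> G \<and> l i > l j}. real (shared_traits T Z i j)) /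
        real (card G choose 2))"

definition gradient :: "(('c \<Rightarrow> real) \<Rightarrow> real) \<Rightarrow> ('c \<Rightarrow> real) \<Rightarrow> 'c \<Rightarrow> real" where
  "gradient f p c = deriv (\<lambda>x. f (p(c := x))) (p c)"

definition inner_on :: "'c set \<Rightarrow> ('c \<Rightarrow> real) \<Rightarrow> ('c \<Rightarrow> real) \<Rightarrow> real" where
  "inner_on A x y = (\<Sum>c\<in>A. x c * y c)"

end

theory Submission imports Defs begin

(* The shared identity S and Q = 1 - (C - 1) / C * D are quadratic forms in p: the kernel of S is
   X(c, d) / T, where X(c, d) is the number of traits in which c and d agree, and the kernel of Q
   is the indicator of c = d. Part (i) compares the two kernels; part (ii) is Cauchy-Schwarz for the
   marginal distribution of each trait. In (iii) the gradient of D is a negative multiple of p, so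
   by Euler's identity for the homogeneous form S the inner product is exactly
   - 4C / (C - 1) * S. The relation with S_N splits the sum of X over G x G into the diagonal
   and twice the sum over unordered pairs. *)

section \<open>Identities, trait marginals and the quadratic form of S\<close>

lemma finite_identities [simp]: "finite (identities T v)"
  by (simp add: identities_def finite_PiE)

lemma identities_component:
  "c \<in> identities T v \<Longrightarrow> t \<in> {1..T} \<Longrightarrow> c t \<in> {1..v t}"
  by (auto simp: identities_def PiE_iff)

text \<open>When \<open>p\<close> is a vector of proportions, this is the share of the group with
  value \<open>u\<close> of trait \<open>t\<close>. It is kept for arbitrary \<open>p\<close>, since
  partial derivatives leave the simplex.\<close>

definition trait_marginal ::
    "nat \<Rightarrow> (nat \<Rightarrow> nat) \<Rightarrow> ((nat \<Rightarrow> nat) \<Rightarrow> real) \<Rightarrow> nat \<Rightarrow> nat \<Rightarrow> real" where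
  "trait_marginal T v p t u = (\<Sum>c\<in>{c \<in> identities T v. c t = u}. p c)"

text \<open>The value of trait \<open>t\<close> partitions the identities into fibres indexed by
  \<open>{1..v t}\<close>. Taking \<open>f\<close> to be the marginal itself rewrites S; taking
  \<open>f\<close> constantly 1 shows that each marginal has the same total mass as
  \<open>p\<close>.\<close>

lemma sum_trait_marginal_mult:
  assumes "t \<in> {1..T}"
  shows "(\<Sum>u=1..v t. trait_marginal T v p t u * f u) = (\<Sum>c\<in>identities T v. p c * f (c t))"
proof -
  have "(\<Sum>u=1..v t. trait_marginal T v p t u * f u)
      = (\<Sum>u=1..v t. \<Sum>c\<in>{c \<in> identities T v. c t = u}. p c * f (c t))"
    by (simp add: trait_marginal_def sum_distrib_right)
  also have "\<dots> = (\<Sum>c\<in>identities T v. p c * f (c t))"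
    using identities_component[OF _ assms] by (intro sum.group) auto
  finally show ?thesis .
qed

lemma shared_identity_eq_marginals:
  "shared_identity T v p = 1 / real T * (\<Sum>t=1..T. \<Sum>u=1..v t. (trait_marginal T v p t u)\<^sup>2)"
  by (simp add: shared_identity_def trait_marginal_def)

text \<open>This is Euler's identity in disguise: the inner sum over \<open>t\<close> turns out to
  be \<open>T / 2\<close> times the partial derivative of S at coordinate \<open>c\<close>.\<close>

lemma shared_identity_eq_sum_marginal:
  "shared_identity T v p =
     1 / real T * (\<Sum>c\<in>identities T v. p c * (\<Sum>t=1..T. trait_marginal T v p t (c t)))"
proof -
  have "(\<Sum>t=1..T. \<Sum>u=1..v t. (trait_marginal T v p t u)\<^sup>2)
      = (\<Sum>t=1..T. \<Sum>c\<in>identities T v. p c * trait_marginal T v p t (c t))"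
    using sum_trait_marginal_mult[where f = "trait_marginal T v p _"]
    by (intro sum.cong) (simp_all add: power2_eq_square)
  also have "\<dots> = (\<Sum>c\<in>identities T v. p c * (\<Sum>t=1..T. trait_marginal T v p t (c t)))"
    by (subst sum.swap) (simp add: sum_distrib_left)
  finally show ?thesis
    by (simp add: shared_identity_eq_marginals)
qed

lemma shared_traits_eq_sum:
  "real (shared_traits T Z i j) = (\<Sum>t=1..T. if Z i t = Z j t then 1 else 0)"
  by (simp add: shared_traits_def flip: sum.inter_filter)

text \<open>Adding the marginals of all traits at the values of \<open>c\<close> counts
  \<open>p d\<close> once for each trait that \<open>d\<close> shares with \<open>c\<close>.\<close>

lemma shared_identity_quadratic_form:
  "shared_identity T v p =
     1 / real T * (\<Sum>c\<in>identities T v. p c *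
       (\<Sum>d\<in>identities T v. p d * real (shared_traits T (\<lambda>c. c) d c)))"
proof -
  have "(\<Sum>t=1..T. trait_marginal T v p t (c t))
      = (\<Sum>d\<in>identities T v. p d * real (shared_traits T (\<lambda>c. c) d c))" for c
  proof -
    have "(\<Sum>d\<in>identities T v. p d * real (shared_traits T (\<lambda>c. c) d c))
        = (\<Sum>d\<in>identities T v. \<Sum>t=1..T. if d t = c t then p d else 0)"
      by (auto simp: shared_traits_eq_sum sum_distrib_left intro!: sum.cong)
    also have "\<dots> = (\<Sum>t=1..T. trait_marginal T v p t (c t))"
      by (subst sum.swap) (simp add: trait_marginal_def sum.inter_filter)
    finally show ?thesis ..
  qed
  then show ?thesis
    by (simp add: shared_identity_eq_sum_marginal)
qed

lemma shared_traits_self [simp]: "shared_traits T Z i i = T"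
  by (simp add: shared_traits_def del: atLeastAtMost_iff)

lemma shared_traits_commute: "shared_traits T Z i j = shared_traits T Z j i"
  unfolding shared_traits_def by (rule arg_cong[of _ _ card]) auto

text \<open>Identities are extensional, so two different ones must already differ at some trait in
  \<open>{1..T}\<close>.\<close>

lemma shared_traits_distinct:
  assumes "c \<in> identities T v" "d \<in> identities T v" "c \<noteq> d"
  shows "shared_traits T (\<lambda>c. c) c d + 1 \<le> T"
proof -
  obtain t where "t \<in> {1..T}" "c t \<noteq> d t"
    using assms PiE_ext unfolding identities_def by blast
  then have "{t \<in> {1..T}. c t = d t} \<subset> {1..T}"
    by blast
  from psubset_card_mono[OF _ this] show ?thesis
    by (simp add: shared_traits_def)
qed

section \<open>Bounds on S: (i) and (ii)\<close>

lemma intersecting_diversity_eq: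
  assumes "card (identities T v) \<ge> 2"
  defines "C \<equiv> real (card (identities T v))"
  shows "(C - 1) / C * intersecting_diversity T v p = 1 - (\<Sum>c\<in>identities T v. (p c)\<^sup>2)"
proof -
  have "C > 1"
    using assms by simp
  then show ?thesis
    by (simp add: intersecting_diversity_def flip: C_def)
qed

text \<open>All terms of the quadratic form are nonnegative; keeping only the diagonal ones, with
  kernel value \<open>T\<close>, gives the bound.\<close>

lemma sum_squares_le_shared_identity:
  assumes "\<And>c. c \<in> identities T v \<Longrightarrow> p c \<ge> 0" and "T \<ge> 1"
  shows "(\<Sum>c\<in>identities T v. (p c)\<^sup>2) \<le> shared_identity T v p"
proof -
  have "p c * (real T * p c)
      \<le> p c * (\<Sum>d\<in>identities T v. p d * real (shared_traits T (\<lambda>c. c) d c))"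
    if c: "c \<in> identities T v" for c
  proof (rule mult_left_mono)
    show "real T * p c \<le> (\<Sum>d\<in>identities T v. p d * real (shared_traits T (\<lambda>c. c) d c))"
      using member_le_sum[of c "identities T v" "\<lambda>d. p d * real (shared_traits T (\<lambda>c. c) d c)"]
        c assms by (simp add: mult.commute)
  qed (use assms c in auto)
  then have "(\<Sum>c\<in>identities T v. p c * (real T * p c)) \<le> real T * shared_identity T v p"
    unfolding shared_identity_quadratic_form using assms(2) by (simp add: sum_mono)
  also have "(\<Sum>c\<in>identities T v. p c * (real T * p c)) = real T * (\<Sum>c\<in>identities T v. (p c)\<^sup>2)"
    by (simp add: sum_distrib_left power2_eq_square algebra_simps)
  finally show ?thesis
    using assms(2) by simp
qed

text \<open>The kernel is \<open>T\<close> on the diagonal and at most \<open>T - 1\<close> off it,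
  so it is dominated by the constant \<open>T - 1\<close> plus the indicator of equality. As
  \<open>p\<close> has mass 1, these contribute \<open>T - 1\<close> and the sum of squares.\<close>

lemma shared_identity_le:
  assumes "\<And>c. c \<in> identities T v \<Longrightarrow> p c \<ge> 0" and "T \<ge> 1"
    and total: "(\<Sum>c\<in>identities T v. p c) = 1"
  shows "shared_identity T v p \<le> 1 - 1 / real T * (1 - (\<Sum>c\<in>identities T v. (p c)\<^sup>2))"
proof -
  have "p c * (\<Sum>d\<in>identities T v. p d * real (shared_traits T (\<lambda>c. c) d c))
      \<le> p c * (real T - 1 + p c)" if c: "c \<in> identities T v" for c
  proof (rule mult_left_mono)
    have "(\<Sum>d\<in>identities T v. p d * real (shared_traits T (\<lambda>c. c) d c))
        \<le> (\<Sum>d\<in>identities T v. p d * (real T - 1) + (if d = c then p d else 0))"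
    proof (rule sum_mono)
      fix d assume d: "d \<in> identities T v"
      show "p d * real (shared_traits T (\<lambda>c. c) d c)
          \<le> p d * (real T - 1) + (if d = c then p d else 0)"
      proof (cases "d = c")
        case False
        with shared_traits_distinct[OF d c] have "real (shared_traits T (\<lambda>c. c) d c) \<le> real T - 1"
          by simp
        with False show ?thesis
          using assms(1)[OF d] by (simp add: mult_left_mono)
      qed (simp add: algebra_simps)
    qed
    also have "\<dots> = real T - 1 + p c"
      using c total by (simp add: sum.distrib flip: sum_distrib_right)
    finally show "(\<Sum>d\<in>identities T v. p d * real (shared_traits T (\<lambda>c. c) d c)) \<le> \<dots>" .
  qed (use assms c in auto)
  then have "real T * shared_identity T v p \<le> (\<Sum>c\<in>identities T v. p c * (real T - 1 + p c))"
    unfolding shared_identity_quadratic_form using assms(2) by (simp add: sum_mono)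
  also have "\<dots> = real T - 1 + (\<Sum>c\<in>identities T v. (p c)\<^sup>2)"
    using total by (simp add: distrib_left sum.distrib power2_eq_square flip: sum_distrib_right)
  finally show ?thesis
    using assms(2) by (simp add: field_simps)
qed

lemma shared_identity_min_le:
  assumes total: "(\<Sum>c\<in>identities T v. p c) = 1"
  shows "shared_identity_min T v \<le> shared_identity T v p"
proof -
  have "1 / real (v t) \<le> (\<Sum>u=1..v t. (trait_marginal T v p t u)\<^sup>2)" if "t \<in> {1..T}" for t
  \<comment> \<open>If \<open>v t = 0\<close>, both sides are 0, because \<open>1 / 0 = 0\<close>
    and the sum is empty. Otherwise Cauchy-Schwarz is applied to the marginal and the constant
    1.\<close>
  proof (cases "v t = 0")
    case False
    have "(\<Sum>u=1..v t. trait_marginal T v p t u) = 1"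
      using sum_trait_marginal_mult[OF that, where f = "\<lambda>_. 1"] total by simp
    then have "1 \<le> (\<Sum>u=1..v t. (trait_marginal T v p t u)\<^sup>2) * real (v t)"
      using Cauchy_Schwarz_ineq_sum[of "trait_marginal T v p t" "\<lambda>_. 1" "{1..v t}"] by simp
    with False show ?thesis
      by (simp add: field_simps)
  qed simp
  then show ?thesis
    unfolding shared_identity_min_def shared_identity_eq_marginals
    by (intro mult_left_mono sum_mono) auto
qed

lemma shared_identity_min_pos:
  assumes "T \<ge> 1" and "\<And>t. t \<in> {1..T} \<Longrightarrow> v t \<ge> 1"
  shows "shared_identity_min T v > 0"
proof -
  have "(\<Sum>t=1..T. 1 / real (v t)) > 0"
    using assms by (intro sum_pos) force+
  with assms(1) show ?thesis
    by (simp add: shared_identity_min_def)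
qed

section \<open>Gradients of D and S for (iii)\<close>

lemma gradient_intersecting_diversity:
  assumes "c \<in> identities T v"
  defines "C \<equiv> real (card (identities T v))"
  shows "gradient (intersecting_diversity T v) p c = - (2 * C / (C - 1)) * p c"
proof -
  have "((\<lambda>x. ((p(c := x)) d)\<^sup>2) has_field_derivative (if d = c then 2 * p c else 0)) (at (p c))"
    for d by (auto intro!: derivative_eq_intros)
  then have "((\<lambda>x. \<Sum>d\<in>identities T v. ((p(c := x)) d)\<^sup>2) has_field_derivative
      (\<Sum>d\<in>identities T v. if d = c then 2 * p c else 0)) (at (p c))"
    by (rule DERIV_sum)
  then have "((\<lambda>x. \<Sum>d\<in>identities T v. ((p(c := x)) d)\<^sup>2) has_field_derivative 2 * p c) (at (p c))"
    using assms(1) by simp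
  then have "((\<lambda>x. C / (C - 1) * (1 - (\<Sum>d\<in>identities T v. ((p(c := x)) d)\<^sup>2)))
      has_field_derivative C / (C - 1) * (0 - 2 * p c)) (at (p c))"
    by (intro DERIV_cmult DERIV_diff DERIV_const)
  from DERIV_imp_deriv[OF this] show ?thesis
    by (simp add: gradient_def intersecting_diversity_def C_def)
qed

lemma DERIV_trait_marginal:
  assumes "c \<in> identities T v"
  shows "((\<lambda>x. trait_marginal T v (p(c := x)) t u) has_field_derivative
    (if c t = u then 1 else 0)) (at (p c))"
proof -
  have "((\<lambda>x. (p(c := x)) d) has_field_derivative (if d = c then 1 else 0)) (at (p c))" for d
    by (auto intro!: derivative_eq_intros)
  then have "((\<lambda>x. trait_marginal T v (p(c := x)) t u) has_field_derivative
      (\<Sum>d\<in>{d \<in> identities T v. d t = u}. if d = c then 1 else 0)) (at (p c))"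
    unfolding trait_marginal_def by (rule DERIV_sum)
  with assms show ?thesis
    by simp
qed

lemma gradient_shared_identity:
  assumes c: "c \<in> identities T v"
  shows "gradient (shared_identity T v) p c =
    2 / real T * (\<Sum>t=1..T. trait_marginal T v p t (c t))"
proof -
  have "((\<lambda>x. (trait_marginal T v (p(c := x)) t u)\<^sup>2) has_field_derivative
      (if c t = u then 2 * trait_marginal T v p t u else 0)) (at (p c))" for t u
    using DERIV_power[OF DERIV_trait_marginal[OF c, of p t u], of 2] by (simp split: if_splits)
  then have "((\<lambda>x. shared_identity T v (p(c := x))) has_field_derivative 1 / real T *
      (\<Sum>t=1..T. \<Sum>u=1..v t. if c t = u then 2 * trait_marginal T v p t u else 0)) (at (p c))"
    unfolding shared_identity_eq_marginals by (intro DERIV_cmult DERIV_sum)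
  \<comment> \<open>For each trait only the marginal at \<open>u = c t\<close> depends on coordinate
    \<open>c\<close>, and \<open>c t\<close> does lie in \<open>{1..v t}\<close>.\<close>
  moreover have "(\<Sum>t=1..T. \<Sum>u=1..v t. if c t = u then 2 * trait_marginal T v p t u else 0)
      = (\<Sum>t=1..T. 2 * trait_marginal T v p t (c t))"
    using identities_component[OF c] by (intro sum.cong) auto
  ultimately show ?thesis
    unfolding gradient_def by (simp add: DERIV_imp_deriv flip: sum_distrib_left)
qed

text \<open>The factor 4 is 2 from the gradient of D, a multiple of \<open>p\<close>, times 2 from
  pairing \<open>p\<close> with the gradient of S, which is homogeneous of degree 2.\<close>

lemma inner_gradients:
  fixes T :: nat and v :: "nat \<Rightarrow> nat"
  defines "C \<equiv> real (card (identities T v))"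
  shows "inner_on (identities T v) (gradient (intersecting_diversity T v) p)
      (gradient (shared_identity T v) p) = - (4 * C / (C - 1)) * shared_identity T v p"
proof -
  have "inner_on (identities T v) (gradient (intersecting_diversity T v) p)
      (gradient (shared_identity T v) p)
    = (\<Sum>c\<in>identities T v. - (4 * C / (C - 1)) * (1 / real T) *
        (p c * (\<Sum>t=1..T. trait_marginal T v p t (c t))))"
    unfolding inner_on_def
    by (intro sum.cong)
       (simp_all add: gradient_intersecting_diversity gradient_shared_identity flip: C_def)
  then show ?thesis
    by (simp only: shared_identity_eq_sum_marginal mult.assoc flip: sum_distrib_left)
qed

section \<open>From proportions to individuals, and the relation with
  \<open>S\<^sub>N\<close>\<close>

lemma sum_proportion_mult:
  assumes "finite G" and "\<And>j. j \<in> G \<Longrightarrow> Z j \<in> identities T v"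
  shows "(\<Sum>c\<in>identities T v. proportion G Z c * f c) = (\<Sum>j\<in>G. f (Z j)) / real (card G)"
proof -
  have "(\<Sum>j\<in>G. f (Z j)) = (\<Sum>c\<in>identities T v. \<Sum>j\<in>{j \<in> G. Z j = c}. f (Z j))"
    using assms by (intro sum.group[symmetric]) auto
  also have "\<dots> = (\<Sum>c\<in>identities T v. real (card {j \<in> G. Z j = c}) * f c)"
    by simp
  finally show ?thesis
    by (simp add: proportion_def sum_divide_distrib)
qed

text \<open>S is the average fraction of shared traits over all ordered pairs drawn with
  replacement.\<close>

lemma shared_identity_proportion:
  assumes "finite G" and "\<And>j. j \<in> G \<Longrightarrow> Z j \<in> identities T v"
  shows "shared_identity T v (proportion G Z) =
    1 / real T * ((\<Sum>i\<in>G. \<Sum>j\<in>G. real (shared_traits T Z i j)) / (real (card G))\<^sup>2)"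
proof -
  have "shared_traits T (\<lambda>c. c) (Z j) (Z i) = shared_traits T Z i j" for i j
    unfolding shared_traits_def by (rule arg_cong[of _ _ card]) auto
  then show ?thesis
    using assms
    by (simp add: shared_identity_quadratic_form sum_proportion_mult power2_eq_square
        flip: sum_divide_distrib)
qed

lemma sum_square_symmetric:
  fixes f :: "'a \<Rightarrow> 'a \<Rightarrow> real" and l :: "'a \<Rightarrow> nat"
  assumes "finite G" and "inj_on l G" and sym: "\<And>i j. f i j = f j i"
  shows "(\<Sum>i\<in>G. \<Sum>j\<in>G. f i j)
    = (\<Sum>i\<in>G. f i i) + 2 * (\<Sum>(i, j)\<in>{(i, j). i \<in> G \<and> j \<in> G \<and> l i > l j}. f i j)"
proof -
  have pairs: "(\<Sum>(i, j)\<in>{(i, j). i \<in> G \<and> j \<in> G \<and> l i > l j}. f i j)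
      = (\<Sum>i\<in>G. \<Sum>j\<in>G. if l i > l j then f i j else 0)"
  proof -
    have "{(i, j). i \<in> G \<and> j \<in> G \<and> l i > l j} = (SIGMA i:G. {j \<in> G. l i > l j})"
      by auto
    with assms(1) show ?thesis
      by (simp add: sum.Sigma[symmetric] sum.inter_filter)
  qed
  \<comment> \<open>As \<open>l\<close> is injective on \<open>G\<close>, exactly one of the three
    cases applies to each pair. The third is written with \<open>f j i\<close> so that exchanging
    the sums turns it into the second.\<close>
  have "(\<Sum>i\<in>G. \<Sum>j\<in>G. f i j) = (\<Sum>i\<in>G. \<Sum>j\<in>G. (if i = j then f i j else 0)
      + (if l i > l j then f i j else 0) + (if l j > l i then f j i else 0))"
    using assms(2) sym by (intro sum.cong) (auto simp: inj_on_def not_less_iff_gr_or_eq)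
  also have "\<dots> = (\<Sum>i\<in>G. f i i) + (\<Sum>i\<in>G. \<Sum>j\<in>G. if l i > l j then f i j else 0)
      + (\<Sum>i\<in>G. \<Sum>j\<in>G. if l j > l i then f j i else 0)"
    using assms(1) by (simp add: sum.distrib)
  also have "(\<Sum>i\<in>G. \<Sum>j\<in>G. if l j > l i then f j i else 0)
      = (\<Sum>i\<in>G. \<Sum>j\<in>G. if l i > l j then f i j else 0)"
    by (rule sum.swap)
  finally show ?thesis
    by (simp add: pairs)
qed

lemma shared_identity_eq_without_replacement:
  assumes "finite G" and "card G \<ge> 2" and "T \<ge> 1" and "inj_on l G"
    and "\<And>j. j \<in> G \<Longrightarrow> Z j \<in> identities T v"
  defines "N \<equiv> real (card G)"
  shows "shared_identity T v (proportion G Z) =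
    (1 - 1 / N) * shared_identity_without_replacement T G l Z + 1 / N"
proof -
  define A where
    "A = (\<Sum>(i, j)\<in>{(i, j). i \<in> G \<and> j \<in> G \<and> l i > l j}. real (shared_traits T Z i j))"
  have N: "N > 1" and "real T > 0"
    using assms by (auto simp: N_def)
  \<comment> \<open>Each of the \<open>N\<close> diagonal pairs shares all \<open>T\<close> traits;
    after normalisation this yields the summand \<open>1 / N\<close>.\<close>
  have "(\<Sum>i\<in>G. \<Sum>j\<in>G. real (shared_traits T Z i j)) = N * real T + 2 * A"
    by (subst sum_square_symmetric[OF assms(1,4)])
       (simp_all add: A_def N_def shared_traits_commute)
  then have "shared_identity T v (proportion G Z) = 1 / real T * ((N * real T + 2 * A) / N\<^sup>2)"
    using shared_identity_proportion[OF assms(1,5)] by (simp add: N_def)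
  moreover have "real (card G choose 2) = N * (N - 1) / 2"
    using assms(2) by (simp add: N_def choose_two real_of_nat_div of_nat_diff)
  then have "shared_identity_without_replacement T G l Z = 1 / real T * (A / (N * (N - 1) / 2))"
    by (simp only: shared_identity_without_replacement_def A_def)
  moreover have "(1 - 1 / N) * (1 / real T * (A / (N * (N - 1) / 2))) = 2 * A / (real T * N\<^sup>2)"
    using N \<open>real T > 0\<close> by (simp add: divide_simps power2_eq_square)
  moreover have "1 / real T * ((N * real T + 2 * A) / N\<^sup>2) = 2 * A / (real T * N\<^sup>2) + 1 / N"
    using N \<open>real T > 0\<close> by (simp add: divide_simps power2_eq_square)
  ultimately show ?thesis
    by simp
qed

theorem theorem1:
  fixes G :: "'a set" and N T :: nat and v :: "nat \<Rightarrow> nat"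
    and Z :: "'a \<Rightarrow> nat \<Rightarrow> nat" and l :: "'a \<Rightarrow> nat"
  assumes "finite G" and "card G = N" and "N \<ge> 2" and "T \<ge> 1"
    and "\<And>t. t \<in> {1..T} \<Longrightarrow> v t \<ge> 1"
    and "card (identities T v) \<ge> 2"
    and "\<And>j. j \<in> G \<Longrightarrow> Z j \<in> identities T v"
    and "bij_betw l G {1..N}"
  shows
    "let C = real (card (identities T v));
         p = proportion G Z;
         D = intersecting_diversity T v p;
         S = shared_identity T v p;
         S\<^sub>m\<^sub>i\<^sub>n = shared_identity_min T v;
         S\<^sub>N = shared_identity_without_replacement T G l Z
     in (1 - (C - 1) / C * D \<le> S \<and> S \<le> 1 - (C - 1) / (real T * C) * D) \<and>
        S\<^sub>m\<^sub>i\<^sub>n \<le> S \<and>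
        (inner_on (identities T v) (gradient (intersecting_diversity T v) p)
             (gradient (shared_identity T v) p)
           \<le> - (4 * C / (C - 1)) * S\<^sub>m\<^sub>i\<^sub>n \<and>
         - (4 * C / (C - 1)) * S\<^sub>m\<^sub>i\<^sub>n < 0) \<and>
        (T = 1 \<longrightarrow> S = 1 - (C - 1) / C * D) \<and>
        S = (1 - 1 / real N) * S\<^sub>N + 1 / real N \<and>
        (\<forall>a b :: real. (a \<le> S \<and> S \<le> b) \<longleftrightarrow>
           ((a * real N - 1) / (real N - 1) \<le> S\<^sub>N \<and>
            S\<^sub>N \<le> (b * real N - 1) / (real N - 1)))"
proof -
  define C where "C = real (card (identities T v))"
  define p where "p = proportion G Z"
  define S where "S = shared_identity T v p"
  define S\<^sub>N where "S\<^sub>N = shared_identity_without_replacement T G l Z"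
  define Q where "Q = (\<Sum>c\<in>identities T v. (p c)\<^sup>2)"
  have "C > 1" and N: "real N > 1"
    using assms by (auto simp: C_def)
  have p_nonneg: "p c \<ge> 0" for c
    by (simp add: p_def proportion_def)
  have total: "(\<Sum>c\<in>identities T v. p c) = 1"
    using sum_proportion_mult[OF assms(1,7), where f = "\<lambda>_. 1"] N assms(2) by (simp add: p_def)
  have D: "(C - 1) / C * intersecting_diversity T v p = 1 - Q"
    using intersecting_diversity_eq[OF assms(6)] by (simp add: C_def Q_def)
  then have DT: "(C - 1) / (real T * C) * intersecting_diversity T v p = 1 / real T * (1 - Q)"
    by (simp add: mult.commute flip: D)
  have lower: "Q \<le> S"
    unfolding S_def Q_def using p_nonneg assms(4) by (intro sum_squares_le_shared_identity)
  have upper: "S \<le> 1 - 1 / real T * (1 - Q)"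
    unfolding S_def Q_def using p_nonneg assms(4) total by (intro shared_identity_le)
  have min_le: "shared_identity_min T v \<le> S"
    unfolding S_def by (rule shared_identity_min_le[OF total])
  have coeff: "- (4 * C / (C - 1)) < 0"
    using \<open>C > 1\<close> by simp
  have inner: "inner_on (identities T v) (gradient (intersecting_diversity T v) p)
      (gradient (shared_identity T v) p) \<le> - (4 * C / (C - 1)) * shared_identity_min T v"
    \<comment> \<open>The inner product equals a negative constant times S, so (ii) is reversed on
      multiplication.\<close>
    using mult_left_mono_neg[OF min_le less_imp_le[OF coeff]]
    by (simp add: inner_gradients C_def S_def)
  have neg: "- (4 * C / (C - 1)) * shared_identity_min T v < 0"
    using coeff shared_identity_min_pos[OF assms(4,5)] by (rule mult_neg_pos)
  have SN: "S = (1 - 1 / real N) * S\<^sub>N + 1 / real N"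
    using shared_identity_eq_without_replacement[OF assms(1) _ assms(4) _ assms(7)]
      assms(2,3) bij_betw_imp_inj_on[OF assms(8)] by (simp add: S_def p_def S\<^sub>N_def)
  \<comment> \<open>Solved for \<open>S\<^sub>N\<close>, the relation is an increasing affine
    function of S because \<open>N > 1\<close>, so bounds transfer in both directions.\<close>
  have "S\<^sub>N = (S * real N - 1) / (real N - 1)"
    unfolding SN using N by (simp add: field_simps)
  then have equiv: "(a \<le> S \<and> S \<le> b) \<longleftrightarrow>
      ((a * real N - 1) / (real N - 1) \<le> S\<^sub>N \<and> S\<^sub>N \<le> (b * real N - 1) / (real N - 1))" for a b
    using N by (simp add: divide_le_cancel)
  \<comment> \<open>For a single trait the two bounds of (i) coincide.\<close>
  have "S = Q" if "T = 1"
    using lower upper that by simp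
  then show ?thesis
    unfolding Let_def C_def[symmetric] p_def[symmetric] S_def[symmetric] S\<^sub>N_def[symmetric] D DT
    using lower upper min_le inner neg SN equiv by auto
qed

end
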